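(* Let $q=3$. Under $G_3$ there are exactly $4$ plane orbits and $4$ point orbits, namely: planes: $\mathcal N_1=\{\Gamma\text{-planes}\}\cup\{\overline{1_{\mathscr C}}\text{-planes}\}$ of size $4+12=16$; $\mathcal N_2=\{2_{\mathscr C}\text{-planes}\}$ of size $12$; $\mathcal N_3=\{3_{\mathscr C}\text{-planes}\}$ of size $4$; $\mathcal N_4=\{0_{\mathscr C}\text{-planes}\}$ of size $8$; points: $\mathcal M_1=\{\mathscr C\text{-points}\}$ of size $4$; $\mathcal M_2=\{4_\Gamma\text{-points}\}\cup\{\text{IC-points}\}$ of size $4+12=16$; $\mathcal M_3=\{\text{TO-points}\}$ of size $8$; $\mathcal M_4=\{\text{RC-points}\}$ of size $12$.
   Context: Notation. $\mathbb F_q$ is the field with $q$ elements, $\mathbb F_q^+=\mathbb F_q\cup\{\infty\}$. Points of $\mathrm{PG}(3,q)$ are written $\mathbf P(x_0,x_1,x_2,x_3)$ with $x$ a nonzero row vector up to scalars; $\boldsymbol\pi(c_0,c_1,c_2,c_3)$ is the plane $c_0x_0+c_1x_1+c_2x_2+c_3x_3=0$. Put $P(t)=\mathbf P(t^3,t^2,t,1)$ for $t\in\mathbb F_q$, $P(\infty)=\mathbf P(1,0,0,0)$, and $\mathscr C=\{P(t):t\in\mathbb F_q^+\}$ (the twisted cubic). The osculating planes are $\pi_{\rm osc}(t)=\boldsymbol\pi(1,-3t,3t^2,-t^3)$ ($t\in\mathbb F_q$) and $\pi_{\rm osc}(\infty)=\boldsymbol\pi(0,0,0,1)$; these $q+1$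 planes are called $\Gamma$-planes. The tangent at $P(t)$, $t\in\mathbb F_q$, is the line through $P(t)$ and $\mathbf P(3t^2,2t,1,0)$; the tangent at $P(\infty)$ is the line through $\mathbf P(1,0,0,0)$ and $\mathbf P(0,1,0,0)$. A real chord is a line through two distinct points of $\mathscr C$. For $\alpha\in\mathbb F_{q^2}\setminus\mathbb F_q$, the line of $\mathrm{PG}(3,q^2)$ through $P(\alpha),P(\alpha^q)$ is defined over $\mathbb F_q$, and the corresponding line of $\mathrm{PG}(3,q)$ is an imaginary chord. $G_q$ is the group of all projectivities of $\mathrm{PG}(3,q)$ mapping $\mathscr C$ onto itself. Plane types: $\Gamma$-plane = osculating plane; $\overline{1_{\mathscr C}}$-plane = non-osculating plane meeting $\mathscr C$ in exactly one point; $d_{\mathscr C}$-plane ($d\in\{0,2,3\}$) = plane meeting $\mathscr C$ in exactly $d$ points. For $q=3$ all four $\Gamma$-planes contain the line $\mathcal A:\ x_0=x_3=0$. Point types for $q=3$: $\mathscr C$-point = point of $\mathscr C$; $4_\Gamma$-point = point of $\mathcal A$; TO-point = point not in $\mathscr C\cup\mathcal A$ lying on a tangent; RC-point = point not in $\mathscr C\cup\mathcal A$, on no tangent, lying on a real chord; IC-point = any point of none of the previous types (such points lie on imaginary chords). *)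

theory Defs
  imports "HOL-Analysis.Analysis"
begin

text \<open>Projective space PG(3,q) over a field 'a (q = CARD('a)).
  Coordinate vectors are elements of 'a ^ 4; vector [x0,x1,x2,x3] is the row
  vector (x0,x1,x2,x3).  A point is represented by the set of its nonzero
  coordinate vectors (a vector up to nonzero scalars); a plane is represented
  by the set of points lying on it.\<close>

definition pt :: "'a::field ^ 4 \<Rightarrow> ('a ^ 4) set" where
  "pt v = {c *s v | c. c \<noteq> 0}"

definition pg_points :: "('a::field ^ 4) set set" where
  "pg_points = {pt v | v. v \<noteq> 0}"

definition dotv :: "'a::field ^ 4 \<Rightarrow> 'a ^ 4 \<Rightarrow> 'a" where
  "dotv c x = (\<Sum>i\<in>UNIV. c $ i * x $ i)"

definition pl :: "'a::field ^ 4 \<Rightarrow> ('a ^ 4) set set" where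
  "pl c = {pt x | x. x \<noteq> 0 \<and> dotv c x = 0}"

definition pg_planes :: "('a::field ^ 4) set set set" where
  "pg_planes = {pl c | c. c \<noteq> 0}"

definition line_through :: "'a::field ^ 4 \<Rightarrow> 'a ^ 4 \<Rightarrow> ('a ^ 4) set set" where
  "line_through u w = {pt (a *s u + b *s w) | a b. a *s u + b *s w \<noteq> 0}"

text \<open>Parameters in F_q^+ = F_q \<union> {\<infinity>} are encoded as 'a option, None = \<infinity>.\<close>
fun cv :: "'a::field option \<Rightarrow> 'a ^ 4" where
  "cv (Some t) = vector [t^3, t^2, t, 1]"
| "cv None = vector [1, 0, 0, 0]"

definition Pc :: "'a::field option \<Rightarrow> ('a ^ 4) set" where
  "Pc t = pt (cv t)"

definition TC :: "('a::field ^ 4) set set" where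
  "TC = range Pc"

fun osc :: "'a::field option \<Rightarrow> ('a ^ 4) set set" where
  "osc (Some t) = pl (vector [1, -3*t, 3*t^2, -(t^3)])"
| "osc None = pl (vector [0, 0, 0, 1])"

fun tangent :: "'a::field option \<Rightarrow> ('a ^ 4) set set" where
  "tangent (Some t) = line_through (vector [t^3, t^2, t, 1]) (vector [3*t^2, 2*t, 1, 0])"
| "tangent None = line_through (vector [1, 0, 0, 0]) (vector [0, 1, 0, 0])"

definition real_chords :: "('a::field ^ 4) set set set" where
  "real_chords = {line_through (cv s) (cv t) | s t. s \<noteq> t}"

definition Gamma_planes :: "('a::field ^ 4) set set set" where
  "Gamma_planes = range osc"

definition one_bar_planes :: "('a::field ^ 4) set set set" where
  "one_bar_planes = {p \<in> pg_planes. p \<notin> Gamma_planes \<and> card (p \<inter> TC) = 1}"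

definition d_planes :: "nat \<Rightarrow> ('a::field ^ 4) set set set" where
  "d_planes d = {p \<in> pg_planes. card (p \<inter> TC) = d}"

definition axisA :: "('a::field ^ 4) set set" where
  "axisA = {pt (vector [0, a, b, 0]) | a b. a \<noteq> 0 \<or> b \<noteq> 0}"

definition C_points :: "('a::field ^ 4) set set" where
  "C_points = TC"

definition Gamma4_points :: "('a::field ^ 4) set set" where
  "Gamma4_points = axisA"

definition TO_points :: "('a::field ^ 4) set set" where
  "TO_points = {p \<in> pg_points. p \<notin> TC \<union> axisA \<and> (\<exists>t. p \<in> tangent t)}"

definition RC_points :: "('a::field ^ 4) set set" where
  "RC_points = {p \<in> pg_points. p \<notin> TC \<union> axisA \<and> \<not> (\<exists>t. p \<in> tangent t)
                 \<and> (\<exists>L\<in>real_chords. p \<in> L)}"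

definition IC_points :: "('a::field ^ 4) set set" where
  "IC_points = pg_points - (TC \<union> axisA \<union> TO_points \<union> RC_points)"

text \<open>Projectivities: induced by invertible 4x4 matrices acting on column
  coordinate vectors.  G_q: projectivities fixing the cubic setwise.\<close>
definition proj_map :: "'a::field ^ 4 ^ 4 \<Rightarrow> ('a ^ 4) set \<Rightarrow> ('a ^ 4) set" where
  "proj_map A p = (\<lambda>v. A *v v) ` p"

definition Gq :: "('a::field ^ 4 ^ 4) set" where
  "Gq = {A. invertible A \<and> proj_map A ` TC = TC}"

definition point_orbit :: "('a::field ^ 4) set \<Rightarrow> ('a ^ 4) set set" where
  "point_orbit p = {proj_map A p | A. A \<in> Gq}"

definition plane_orbit :: "('a::field ^ 4) set set \<Rightarrow> ('a ^ 4) set set set" where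
  "plane_orbit p = {proj_map A ` p | A. A \<in> Gq}"

definition point_orbits :: "('a::field ^ 4) set set set" where
  "point_orbits = point_orbit ` pg_points"

definition plane_orbits :: "('a::field ^ 4) set set set set" where
  "plane_orbits = plane_orbit ` pg_planes"

end

theory Submission
  imports Defs
begin

text \<open>For \<open>q = 3\<close> the cubic consists of four points in general position, so it is a coordinate frame,
  and the group \<open>G\<^sub>3\<close> acts as the group of all monomial matrices with respect to it. Hence two points
  lie in one orbit iff they have the same number of nonzero coordinates in this frame, and there are
  \<open>(4 choose w) * 2 ^ (w - 1)\<close> points with \<open>w\<close> nonzero coordinates. Dually, planes are classified by the
  number of points of the cubic on which the defining form does not vanish. Tangents contribute the
  points with four nonzero coordinates, chords those with two, and the axis \<open>\<A>\<close> lies among those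
  with three.\<close>

subsection \<open>Projective points and planes over an arbitrary field\<close>

lemma vector_4 [simp]:
  "(vector [x, y, z, w] :: 'a::zero ^ 4) $ 1 = x"
  "(vector [x, y, z, w] :: 'a::zero ^ 4) $ 2 = y"
  "(vector [x, y, z, w] :: 'a::zero ^ 4) $ 3 = z"
  "(vector [x, y, z, w] :: 'a::zero ^ 4) $ 4 = w"
  unfolding vector_def by simp_all

lemma pt_self: "v \<in> pt (v :: 'a::field ^ 4)"
  unfolding pt_def by (metis (mono_tags, lifting) mem_Collect_eq one_neq_zero vec.scale_one)

lemma mem_pt_iff: "u \<in> pt v \<longleftrightarrow> (\<exists>c. c \<noteq> 0 \<and> u = c *s (v :: 'a::field ^ 4))"
  unfolding pt_def by auto

lemma pt_scale: "c \<noteq> 0 \<Longrightarrow> pt (c *s v) = pt (v :: 'a::field ^ 4)"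
proof -
  assume c: "c \<noteq> 0"
  have "d *s v = (d / c) *s (c *s v)" for d
    using c by (simp add: vec.scale_scale)
  moreover have "d *s (c *s v) = (d * c) *s v" for d
    by (simp add: vec.scale_scale)
  ultimately show ?thesis
    using c unfolding pt_def set_eq_iff mem_Collect_eq by (metis divide_eq_0_iff mult_eq_0_iff)
qed

lemma pt_eq_iff: "pt u = pt v \<longleftrightarrow> (\<exists>c. c \<noteq> 0 \<and> u = c *s (v :: 'a::field ^ 4))"
  by (metis mem_pt_iff pt_scale pt_self)

lemma pt_nonzero: "pt u = pt v \<Longrightarrow> u \<noteq> 0 \<Longrightarrow> (v :: 'a::field ^ 4) \<noteq> 0"
  by (auto simp: pt_eq_iff)

lemma pt_disjoint: "pt u \<noteq> pt v \<Longrightarrow> pt u \<inter> pt (v :: 'a::field ^ 4) = {}"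
  by (metis disjoint_iff mem_pt_iff pt_scale)

lemma pt_mem_points_iff: "pt v \<in> pg_points \<longleftrightarrow> (v :: 'a::field ^ 4) \<noteq> 0"
  unfolding pg_points_def mem_Collect_eq by (metis pt_nonzero)

lemma proj_map_pt: "proj_map A (pt v) = pt (A *v (v :: 'a::field ^ 4))"
proof (rule set_eqI)
  show "y \<in> proj_map A (pt v) \<longleftrightarrow> y \<in> pt (A *v v)" for y
    unfolding proj_map_def image_iff mem_pt_iff Bex_def by (metis vector_scalar_commute)
qed

lemma mult_vec_sum: "A *v (\<Sum>i\<in>I. f i) = (\<Sum>i\<in>I. A *v (f i :: 'a::field ^ 4))"
  by (induction I rule: infinite_finite_induct) (simp_all add: matrix_vector_right_distrib)

lemma pt_mem_line_through_iff:
  "pt x \<in> line_through u v \<longleftrightarrow> x \<noteq> 0 \<and> (\<exists>a b. x = a *s u + b *s (v :: 'a::field ^ 4))"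
proof
  assume "pt x \<in> line_through u v"
  then obtain a b where ab: "pt x = pt (a *s u + b *s v)" "a *s u + b *s v \<noteq> 0"
    unfolding line_through_def by auto
  then obtain k where "x = k *s (a *s u + b *s v)"
    unfolding pt_eq_iff by blast
  then have "x = (k * a) *s u + (k * b) *s v"
    by (simp add: vec.scale_right_distrib)
  then show "x \<noteq> 0 \<and> (\<exists>a b. x = a *s u + b *s v)"
    using ab pt_nonzero[OF ab(1)[symmetric]] by blast
qed (auto simp: line_through_def)

text \<open>Reduces equality of point sets to a test on coordinate vectors, where the finite case
  checks below apply.\<close>

lemma point_set_eqI:
  assumes "X \<subseteq> pg_points" "Y \<subseteq> pg_points"
    and "\<And>x. x \<noteq> 0 \<Longrightarrow> pt x \<in> X \<longleftrightarrow> pt (x :: 'a::field ^ 4) \<in> Y"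
  shows "X = Y"
proof -
  have "p \<in> X \<longleftrightarrow> p \<in> Y" if "p \<in> pg_points" for p
    using that assms(3) unfolding pg_points_def by auto
  with assms(1,2) show ?thesis
    by blast
qed

lemma dotv_scale: "dotv c (k *s x) = k * dotv c (x :: 'a::field ^ 4)"
  by (simp add: dotv_def sum_distrib_left mult.left_commute)

lemma dotv_scale_left: "dotv (k *s c) x = k * dotv c (x :: 'a::field ^ 4)"
  by (simp add: dotv_def sum_distrib_left mult.assoc)

lemma dotv_add: "dotv c (x + y) = dotv c x + dotv c (y :: 'a::field ^ 4)"
  by (simp add: dotv_def sum.distrib distrib_left)

lemma dotv_sum: "dotv c (\<Sum>i\<in>I. f i) = (\<Sum>i\<in>I. dotv c (f i :: 'a::field ^ 4))"
  by (induction I rule: infinite_finite_induct) (simp_all add: dotv_add, simp_all add: dotv_def)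

lemma dotv_pt_zero_iff: "pt u = pt v \<Longrightarrow> dotv c u = 0 \<longleftrightarrow> dotv c (v :: 'a::field ^ 4) = 0"
  by (auto simp: pt_eq_iff dotv_scale)

lemma pt_mem_pl_iff: "pt x \<in> pl c \<longleftrightarrow> x \<noteq> 0 \<and> dotv c (x :: 'a::field ^ 4) = 0"
  unfolding pl_def mem_Collect_eq by (metis dotv_pt_zero_iff pt_nonzero)

text \<open>A nonzero linear form is determined up to a scalar by its zeros. Hence planes correspond
  bijectively to points of the dual space, and counting planes reduces to counting vectors up to
  scalars.\<close>

lemma pl_eq_iff:
  assumes "c \<noteq> 0" "d \<noteq> (0 :: 'a::field ^ 4)"
  shows "pl c = pl d \<longleftrightarrow> pt c = pt d"
proof
  assume "pt c = pt d"
  then show "pl c = pl d"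
    unfolding pt_eq_iff pl_def by (elim exE conjE) (simp add: dotv_scale_left)
next
  assume eq: "pl c = pl d"
  have ker: "dotv d x = 0" if "dotv c x = 0" for x
    using that eq pt_mem_pl_iff[of x c] pt_mem_pl_iff[of x d] by (cases "x = 0") (auto simp: dotv_def)
  obtain i where i: "c $ i \<noteq> 0"
    using assms(1) by (metis vec_eq_iff zero_index)
  have ax: "dotv e (axis j k) = e $ j * k" for e :: "'a ^ 4" and j k
    by (simp add: dotv_def axis_def if_distrib cong: if_cong)
  have cross: "c $ i * d $ j = d $ i * c $ j" for j
  proof -
    \<comment> \<open>This vector is the standard element of the kernel of \<open>c\<close>
      supported on \<open>i\<close> and \<open>j\<close>; applying \<open>d\<close> to it shows that
      the 2 by 2 minors of \<open>c\<close> and \<open>d\<close> involving \<open>i\<close>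
      vanish.\<close>
    have "dotv c (axis j (c $ i) + axis i (- (c $ j))) = 0"
      by (simp add: dotv_add ax)
    from ker[OF this] show ?thesis
      by (simp add: dotv_add ax algebra_simps)
  qed
  have d: "d = (d $ i / c $ i) *s c"
    unfolding vec_eq_iff
  proof
    fix j
    show "d $ j = ((d $ i / c $ i) *s c) $ j"
      using i cross[of j] by (simp add: nonzero_eq_divide_eq mult.commute)
  qed
  with assms(2) have "d $ i / c $ i \<noteq> 0"
    by (metis vec.scale_zero_left)
  with d show "pt c = pt d"
    by (metis pt_scale)
qed

text \<open>Choosing a representative vector turns a point of the dual space into a plane; by
  \<open>pl_eq_iff\<close> the plane is independent of the choice and the map is injective.\<close>

lemma card_pl_image:
  assumes "0 \<notin> (X :: ('a::field ^ 4) set)"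
  shows "card (pl ` X) = card (pt ` X)"
proof -
  define f where "f p = pl (SOME v. v \<in> p)" for p :: "('a ^ 4) set"
  have f: "f (pt c) = pl c" if "c \<noteq> 0" for c
  proof -
    have "(SOME v. v \<in> pt c) \<in> pt c"
      by (rule someI, rule pt_self)
    then have "pt (SOME v. v \<in> pt c) = pt c"
      by (metis mem_pt_iff pt_scale)
    moreover from this have "(SOME v. v \<in> pt c) \<noteq> 0"
      by (metis pt_nonzero that)
    ultimately show ?thesis
      unfolding f_def using that pl_eq_iff by blast
  qed
  have "pl ` X = f ` pt ` X"
    unfolding image_image
  proof (rule image_cong[OF refl])
    fix c assume "c \<in> X"
    then have "c \<noteq> 0"
      using assms by blast
    then show "pl c = f (pt c)"
      by (simp add: f)
  qed
  moreover have "inj_on f (pt ` X)"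
  proof (intro inj_onI, clarify)
    fix c d assume "c \<in> X" "d \<in> X" "f (pt c) = f (pt d)"
    moreover from this have "c \<noteq> 0" "d \<noteq> 0"
      using assms by blast+
    ultimately show "pt c = pt d"
      by (simp add: f pl_eq_iff)
  qed
  ultimately show ?thesis
    by (simp add: card_image)
qed

text \<open>A projectivity acts on forms by the inverse transpose. Stating this as the invariance of
  the pairing avoids writing that matrix down.\<close>

lemma proj_map_pl:
  assumes inv: "invertible (A :: 'a::field ^ 4 ^ 4)"
    and d: "\<And>x. dotv d (A *v x) = dotv c x"
  shows "proj_map A ` pl c = pl d"
proof -
  obtain B where AB: "A ** B = mat 1" and BA: "B ** A = mat 1"
    using inv unfolding invertible_def by blast
  have A: "A *v (B *v y) = y" and B: "B *v (A *v y) = y" for y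
    using AB BA by (simp_all add: matrix_vector_mul_assoc)
  have nz: "A *v x \<noteq> 0" if "x \<noteq> 0" for x
    using B[of x] that by auto
  show ?thesis
  proof (intro equalityI subsetI)
    fix p assume "p \<in> proj_map A ` pl c"
    then obtain x where "x \<noteq> 0" "dotv c x = 0" "p = pt (A *v x)"
      unfolding pl_def by (auto simp: proj_map_pt)
    then show "p \<in> pl d"
      by (simp add: pt_mem_pl_iff d nz)
  next
    fix p assume "p \<in> pl d"
    then obtain y where y: "y \<noteq> 0" "dotv d y = 0" "p = pt y"
      unfolding pl_def by auto
    then have "pt (B *v y) \<in> pl c"
      using A[of y] d[of "B *v y"] by (auto simp: pt_mem_pl_iff)
    moreover have "p = proj_map A (pt (B *v y))"
      by (simp add: proj_map_pt A y)
    ultimately show "p \<in> proj_map A ` pl c"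
      by blast
  qed
qed

subsection \<open>Counting functions by the size of their support\<close>

text \<open>Choose the support, then a nonzero value at each of its elements. Finiteness is an
  explicit hypothesis because the type of the field carries no finiteness class.\<close>

lemma card_support_eq:
  assumes "finite (UNIV :: 'b set)" "finite (UNIV :: 'a::zero set)"
  shows "card {y :: 'b \<Rightarrow> 'a. card {t. y t \<noteq> 0} = w} = (CARD('b) choose w) * (CARD('a) - 1) ^ w"
proof -
  let ?F = "\<lambda>S :: 'b set. S \<rightarrow>\<^sub>E (- {0 :: 'a})"
  have fin: "finite S" for S :: "'b set"
    using assms(1) by (rule finite_subset[rotated]) simp
  have fin': "finite S" for S :: "'a set"
    using assms(2) by (rule finite_subset[rotated]) simp
  \<comment> \<open>Functions in \<open>?F S\<close> are undefined off \<open>S\<close>;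
    \<open>extend\<close> replaces that default by 0, so that \<open>S\<close> becomes exactly the
    support.\<close>
  define extend :: "'b set \<times> ('b \<Rightarrow> 'a) \<Rightarrow> 'b \<Rightarrow> 'a"
    where "extend = (\<lambda>(S, f) t. if t \<in> S then f t else 0)"
  have supp: "{t. extend (S, f) t \<noteq> 0} = S" if "f \<in> ?F S" for S f
    using that by (auto simp: extend_def PiE_def Pi_def)
  have restr: "restrict (extend (S, f)) S = f" if "f \<in> ?F S" for S f
    using that by (auto simp: extend_def PiE_def extensional_def restrict_def)
  have "bij_betw extend (SIGMA S:{S. card S = w}. ?F S) {y. card {t. y t \<noteq> 0} = w}"
    by (rule bij_betw_byWitness[where f' = "\<lambda>y. ({t. y t \<noteq> 0}, restrict y {t. y t \<noteq> 0})"])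
      (auto simp: supp restr, auto simp: extend_def)
  then have "card {y :: 'b \<Rightarrow> 'a. card {t. y t \<noteq> 0} = w} = card (SIGMA S:{S. card S = w}. ?F S)"
    by (simp add: bij_betw_same_card)
  also have "\<dots> = (\<Sum>S | card S = w. card (?F S))"
  proof (intro card_SigmaI ballI)
    show "finite {S :: 'b set. card S = w}"
      using assms(1) by (metis Pow_UNIV finite_Pow_iff finite_subset subset_UNIV)
    show "finite (?F S)" for S
      by (intro finite_PiE fin fin')
  qed
  also have "\<dots> = (\<Sum>S | card (S :: 'b set) = w. (CARD('a) - 1) ^ w)"
    using assms(2) by (intro sum.cong refl) (simp add: card_funcsetE[OF fin] Compl_eq_Diff_UNIV)
  also have "\<dots> = (CARD('b) choose w) * (CARD('a) - 1) ^ w"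
    using n_subsets[OF assms(1), of w] by simp
  finally show ?thesis .
qed

text \<open>Glue a bijection from \<open>S\<close> to \<open>T\<close> with one between the
  complements, which have equal size because the type is finite.\<close>

lemma ex_bij_image_eq:
  assumes "finite (UNIV :: 'b set)" "card S = card (T :: 'b set)"
  shows "\<exists>\<sigma> :: 'b \<Rightarrow> 'b. bij \<sigma> \<and> (\<forall>t. \<sigma> t \<in> T \<longleftrightarrow> t \<in> S)"
proof -
  have fin: "finite R" for R :: "'b set"
    using assms(1) by (rule finite_subset[rotated]) simp
  obtain f where f: "bij_betw f S T"
    using assms(2) fin finite_same_card_bij by metis
  obtain g where g: "bij_betw g (- S) (- T)"
    using assms fin finite_same_card_bij[of "- S" "- T"]
    by (auto simp: Compl_eq_Diff_UNIV card_Diff_subset)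
  have "bij_betw (\<lambda>x. if x \<in> S then f x else g x) (S \<union> - S) (T \<union> - T)"
    by (rule bij_betw_disjoint_Un[OF f g]) auto
  then show ?thesis
    using f g by (intro exI[of _ "\<lambda>x. if x \<in> S then f x else g x"])
      (auto simp: bij_betw_apply dest: bij_betw_apply)
qed

subsection \<open>Coordinates with respect to the points of the cubic\<close>

definition comb :: "('a::field option \<Rightarrow> 'a) \<Rightarrow> 'a ^ 4" where
  "comb y = (\<Sum>t\<in>UNIV. y t *s cv t)"

text \<open>The inverse of \<open>comb\<close> in characteristic 3: the divisions by 2 become sign changes.\<close>

definition coords :: "'a::field ^ 4 \<Rightarrow> 'a option \<Rightarrow> 'a" where
  "coords x t = (case t of None \<Rightarrow> x $ 1 - x $ 3 | Some s \<Rightarrow> (1 - s^2) * x $ 4 - x $ 2 - s * x $ 3)"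

text \<open>The dual counterpart of \<open>coords\<close>: the coordinates of a linear form with
  respect to the basis dual to the frame, once the vectors \<open>cv t\<close> form a basis.\<close>

definition evals :: "'a::field ^ 4 \<Rightarrow> 'a option \<Rightarrow> 'a" where
  "evals c t = dotv c (cv t)"

definition supp_size :: "('b \<Rightarrow> 'a::zero) \<Rightarrow> nat" where
  "supp_size y = card {t. y t \<noteq> 0}"

definition weight_points :: "nat \<Rightarrow> ('a::field ^ 4) set set" where
  "weight_points w = pt ` {x. supp_size (coords x) = w}"

lemma supp_size_scale: "c \<noteq> 0 \<Longrightarrow> supp_size (\<lambda>t. c * y t) = supp_size (y :: 'b \<Rightarrow> 'a::field)"
  by (simp add: supp_size_def)

lemma coords_scale: "coords (c *s x) = (\<lambda>t. c * coords x t)"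
  by (auto simp: coords_def fun_eq_iff algebra_simps split: option.split)

lemma coords_add: "coords (x + y) = (\<lambda>t. coords x t + coords y t)"
  by (auto simp: coords_def fun_eq_iff algebra_simps split: option.split)

lemma coords_sum: "coords (\<Sum>i\<in>I. f i) = (\<lambda>t. \<Sum>i\<in>I. coords (f i) t)"
  by (induction I rule: infinite_finite_induct)
    (auto simp: coords_add, auto simp: coords_def fun_eq_iff split: option.split)

lemma pt_mem_weight_points_iff: "pt x \<in> weight_points w \<longleftrightarrow> supp_size (coords x) = w"
proof -
  have "supp_size (coords x) = supp_size (coords y)" if "pt x = pt y" for x y :: "'a ^ 4"
    using that by (auto simp: pt_eq_iff coords_scale supp_size_scale)
  then show ?thesis
    unfolding weight_points_def by blast
qed

lemma supp_size_bij:
  assumes "bij \<sigma>" "\<And>t. z (\<sigma> t) = 0 \<longleftrightarrow> y t = 0"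
  shows "supp_size z = supp_size y"
proof -
  have "bij_betw \<sigma> {t. y t \<noteq> 0} {t. z t \<noteq> 0}"
    using assms by (intro bij_betwI') (auto simp: bij_def inj_eq, metis surjD)
  then show ?thesis
    unfolding supp_size_def by (simp add: bij_betw_same_card)
qed

lemma weight_points_disjoint:
  "v \<noteq> w \<Longrightarrow> weight_points v \<inter> (weight_points w :: ('a::field ^ 4) set set) = {}"
proof (rule ccontr)
  assume "v \<noteq> w" and "weight_points v \<inter> (weight_points w :: ('a ^ 4) set set) \<noteq> {}"
  then obtain x :: "'a ^ 4" where "pt x \<in> weight_points v" "pt x \<in> weight_points w"
    unfolding weight_points_def by auto
  with \<open>v \<noteq> w\<close> show False
    by (simp add: pt_mem_weight_points_iff)
qed

section \<open>The field with three elements and the frame over it\<close>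

context
  assumes q3: "CARD('a::field) = 3"
begin

text \<open>Let \<open>u\<close> be the third element. If -1 equalled 1, then \<open>u + 1\<close>
  could be none of 0, 1 and \<open>u\<close>. So -1 is neither 0 nor 1 and must be
  \<open>u\<close>.\<close>

lemma neg1_neq_1: "(-1 :: 'a) \<noteq> 1" and UNIV_F3: "(UNIV :: 'a set) = {0, 1, -1}"
proof -
  obtain u :: 'a where u: "u \<noteq> 0" "u \<noteq> 1"
  proof (rule ccontr)
    assume "\<not> thesis"
    then have "(UNIV :: 'a set) = {0, 1}"
      using that by auto
    then show False
      using q3 card_insert_le_m1[of 2 "{1 :: 'a}" 0] by simp
  qed
  have fin: "finite (UNIV :: 'a set)"
    using q3 by (metis card.infinite zero_neq_numeral)
  have U: "UNIV = {0, 1, u}"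
    using card_subset_eq[OF fin, of "{0, 1, u}"] u q3 by simp
  show n: "(-1 :: 'a) \<noteq> 1"
  proof
    assume "(-1 :: 'a) = 1"
    moreover have "u + 1 = 0 \<or> u + 1 = 1 \<or> u + 1 = u"
      using U by blast
    ultimately show False
      using u by (metis add_cancel_left_left add_cancel_right_right eq_neg_iff_add_eq_0 zero_neq_one)
  qed
  have "- 1 = (0 :: 'a) \<or> - 1 = (1 :: 'a) \<or> - 1 = u"
    using U by blast
  then have "u = - 1"
    using n by simp
  with U show "(UNIV :: 'a set) = {0, 1, -1}"
    by simp
qed

lemma F3_cases: "a = 0 \<or> a = 1 \<or> a = (-1 :: 'a)"
  using UNIV_F3 by blast

lemma F3_two: "(2 :: 'a) = -1" and F3_three: "(3 :: 'a) = 0"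
proof -
  have "(2 :: 'a) \<noteq> 1" "(2 :: 'a) \<noteq> 0"
    using neg1_neq_1 by (metis add_cancel_right_right one_add_one zero_neq_one)
      (metis neg1_neq_1 add_eq_0_iff one_add_one)
  then show two: "(2 :: 'a) = -1"
    using F3_cases by blast
  have "(3 :: 'a) = 2 + 1"
    by simp
  then show "(3 :: 'a) = 0"
    by (simp only: two) simp
qed

lemma UNIV_param: "(UNIV :: 'a option set) = {None, Some 0, Some 1, Some (-1)}"
  using F3_cases by (auto simp: not_None_eq)

lemma card_param: "CARD('a option) = 4"
  unfolding UNIV_param using neg1_neq_1 by simp

lemma finite_param: "finite (UNIV :: 'a option set)"
  unfolding UNIV_param by simp

lemma finite_F3: "finite (UNIV :: 'a set)"
  unfolding UNIV_F3 by simp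

lemma sum_param: "(\<Sum>t\<in>UNIV. f t) = f None + f (Some 0) + f (Some 1) + f (Some (-1 :: 'a))"
  unfolding UNIV_param using neg1_neq_1 by (simp add: add.assoc)

lemma all_param: "(\<forall>t. Q t) \<longleftrightarrow> Q None \<and> Q (Some 0) \<and> Q (Some 1) \<and> Q (Some (-1 :: 'a))"
  by (metis F3_cases option.exhaust)

text \<open>A finite check over the values of the four entries of \<open>x\<close>. With
  \<open>coords_comb\<close> it shows that the four vectors \<open>cv t\<close> form a
  basis.\<close>

lemma comb_coords: "comb (coords x) = (x :: 'a ^ 4)"
  using F3_cases[of "x $ 1"] F3_cases[of "x $ 2"] F3_cases[of "x $ 3"] F3_cases[of "x $ 4"]
  unfolding vec_eq_iff forall_4 comb_def sum_param
  by (auto simp: coords_def F3_two)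

lemma coords_comb: "coords (comb y) = (y :: 'a option \<Rightarrow> 'a)"
  using F3_cases[of "y None"] F3_cases[of "y (Some 0)"] F3_cases[of "y (Some 1)"] F3_cases[of "y (Some (-1))"]
  unfolding fun_eq_iff all_param comb_def sum_param
  by (auto simp: coords_def F3_two)

lemma bij_coords: "bij (coords :: 'a ^ 4 \<Rightarrow> _)"
  by (rule bij_betw_byWitness[where f' = comb]) (auto simp: comb_coords coords_comb)

lemma bij_evals: "bij (evals :: 'a ^ 4 \<Rightarrow> _)"
proof -
  \<comment> \<open>Interpolation of a polynomial of degree at most 3: the leading coefficient is
    the value at infinity and the constant one is the value at 0. The sum and difference of the
    values at 1 and -1 then give the other two, with 2 read as -1.\<close>
  define c :: "('a option \<Rightarrow> 'a) \<Rightarrow> 'a ^ 4" where "c z = vector [z None, - (z (Some 1) + z (Some (-1))) - z (Some 0),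
    z (Some (-1)) - z (Some 1) - z None, z (Some 0)]" for z
  have "c (evals d) = d" for d
    using F3_cases[of "d $ 1"] F3_cases[of "d $ 2"] F3_cases[of "d $ 3"] F3_cases[of "d $ 4"]
    unfolding vec_eq_iff forall_4 by (auto simp: c_def evals_def dotv_def sum_4 F3_two)
  moreover have "evals (c z) = z" for z
    using F3_cases[of "z None"] F3_cases[of "z (Some 0)"] F3_cases[of "z (Some 1)"] F3_cases[of "z (Some (-1))"]
    unfolding fun_eq_iff all_param by (auto simp: c_def evals_def dotv_def sum_4 F3_two)
  ultimately show ?thesis
    by (intro bij_betw_byWitness[where f' = c]) auto
qed

lemma coords_cv: "coords (cv s) t = (if s = t then 1 else (0 :: 'a))"
proof -
  have "comb (\<lambda>t. if s = t then 1 else 0) = cv s"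
    unfolding comb_def using finite_param by (simp add: if_distrib[of "\<lambda>k. k *s _"] cong: if_cong)
  with coords_comb[of "\<lambda>t. if s = t then 1 else 0"] show ?thesis
    by simp
qed

lemma cv_neq_0: "cv t \<noteq> (0 :: 'a ^ 4)"
  by (cases t) (auto simp: vec_eq_iff forall_4)

lemma Pc_eq_iff: "Pc s = Pc t \<longleftrightarrow> s = (t :: 'a option)"
proof
  assume "Pc s = Pc t"
  then obtain k where "cv s = k *s cv t" "k \<noteq> 0"
    unfolding Pc_def pt_eq_iff by blast
  then have "coords (cv s) t = k * coords (cv t) t"
    by (simp add: coords_scale)
  with \<open>k \<noteq> 0\<close> show "s = t"
    by (simp add: coords_cv split: if_splits)
qed simp

text \<open>The only nonzero scalars are 1 and -1, so each point is a pair of opposite vectors, and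
  these pairs partition \<open>X\<close>.\<close>

lemma card_pt_image:
  assumes X: "0 \<notin> X" "\<And>x. x \<in> X \<Longrightarrow> - x \<in> (X :: ('a ^ 4) set)" "finite X"
  shows "card X = 2 * card (pt ` X)"
proof -
  have pt: "pt x = {x, - x}" for x :: "'a ^ 4"
  proof -
    have nz: "{c :: 'a. c \<noteq> 0} = {1, -1}"
      using UNIV_F3 by auto
    have "pt x = (\<lambda>c. c *s x) ` {c. c \<noteq> 0}"
      unfolding pt_def by blast
    then show ?thesis
      unfolding nz by simp
  qed
  have "x \<noteq> - x" if x: "x \<noteq> 0" for x :: "'a ^ 4"
  proof -
    have "a \<noteq> - a" if "a \<noteq> 0" for a :: 'a
      using that F3_cases[of a] neg1_neq_1 by auto
    moreover obtain i where "x $ i \<noteq> 0"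
      using x by (metis vec_eq_iff zero_index)
    ultimately show ?thesis
      by (metis vector_uminus_component)
  qed
  then have c: "card (pt x) = 2" if "x \<in> X" for x
    using X that unfolding pt card_2_iff by metis
  have U: "\<Union>(pt ` X) = X"
    using X by (auto simp: pt)
  have "2 * card (pt ` X) = card (\<Union>(pt ` X))"
  proof (rule card_partition)
    show "p \<inter> q = {}" if "p \<in> pt ` X" "q \<in> pt ` X" "p \<noteq> q" for p q
      using that pt_disjoint by (elim imageE) simp
  qed (use X U c in auto)
  then show ?thesis
    by (simp add: U)
qed

lemma finite_space: "finite (X :: ('a ^ 4) set)"
proof -
  have "finite (UNIV :: ('a option \<Rightarrow> 'a) set)"
    using finite_param finite_F3 by (simp add: finite_UNIV_fun)
  then have "finite (UNIV :: ('a ^ 4) set)"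
    using bij_coords bij_betw_finite by blast
  then show ?thesis
    by (rule finite_subset[rotated]) simp
qed

text \<open>One count for both sides of the duality: \<open>F\<close> is \<open>coords\<close> for
  points and \<open>evals\<close> for planes. Since \<open>w\<close> is nonzero, the zero vector,
  which has no distinct opposite, is excluded.\<close>

lemma card_pt_image_support:
  fixes F :: "'a ^ 4 \<Rightarrow> 'a option \<Rightarrow> 'a"
  assumes "bij F" and scale: "\<And>c x. F (c *s x) = (\<lambda>t. c * F x t)" and w: "w \<noteq> 0"
  shows "2 * card (pt ` {x. supp_size (F x) = w}) = (4 choose w) * 2 ^ w"
proof -
  let ?X = "{x. supp_size (F x) = w}"
  have "F 0 = (\<lambda>t. 0)"
    using scale[of 0 0] by simp
  then have "0 \<notin> ?X"
    using w by (simp add: supp_size_def)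
  moreover have "- x \<in> ?X" if "x \<in> ?X" for x
  proof -
    have "F (- x) = (\<lambda>t. (-1) * F x t)"
      using scale[of "-1" x] by simp
    with that show ?thesis
      by (simp add: supp_size_def)
  qed
  ultimately have "card ?X = 2 * card (pt ` ?X)"
    using finite_space by (intro card_pt_image)
  moreover have "bij_betw F ?X {y. supp_size y = w}"
    using assms(1) by (intro bij_betwI') (auto simp: bij_def inj_eq, metis surjD)
  then have "card ?X = (4 choose w) * 2 ^ w"
    using card_support_eq[OF finite_param finite_F3, of w]
    by (simp add: bij_betw_same_card supp_size_def card_param q3)
  ultimately show ?thesis
    by simp
qed

lemma card_weight_points:
  "w \<noteq> 0 \<Longrightarrow> 2 * card (weight_points w :: ('a ^ 4) set set) = (4 choose w) * 2 ^ w"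
  unfolding weight_points_def by (rule card_pt_image_support[OF bij_coords coords_scale])

subsection \<open>The group is the monomial group of the cubic\<close>

text \<open>Any permutation of a basis with nonzero multipliers extends to an invertible linear map,
  and this map permutes the four points of the cubic.\<close>

lemma ex_Gq_monomial:
  fixes m :: "'a option \<Rightarrow> 'a"
  assumes \<sigma>: "bij \<sigma>" and m: "\<And>t. m t \<noteq> 0"
  shows "\<exists>A\<in>Gq. \<forall>t. A *v cv t = m t *s cv (\<sigma> t)"
proof -
  note fin = finite_param
  define f where "f x = (\<Sum>t\<in>UNIV. (coords x t * m t) *s cv (\<sigma> t))" for x :: "'a ^ 4"
  have "Vector_Spaces.linear (*s) (*s) f"
    by unfold_locales
      (simp_all add: f_def coords_add coords_scale vec.scale_left_distrib distrib_right sum.distrib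
        vec.scale_sum_right mult.assoc)
  then have A: "matrix f *v x = f x" for x
    by (rule matrix_works)
  have cv: "matrix f *v cv t = m t *s cv (\<sigma> t)" for t
  proof -
    have "f (cv t) = (\<Sum>s\<in>UNIV. if t = s then m s *s cv (\<sigma> s) else 0)"
      unfolding f_def by (rule sum.cong) (auto simp: coords_cv)
    then show ?thesis
      using fin by (simp add: A)
  qed
  have coords: "coords (f x) (\<sigma> t) = coords x t * m t" for x t
  proof -
    have "coords (f x) (\<sigma> t) = (\<Sum>s\<in>UNIV. if s = t then coords x s * m s else 0)"
      unfolding f_def coords_sum using \<sigma>
      by (intro sum.cong) (auto simp: coords_scale coords_cv bij_def inj_eq)
    then show ?thesis
      using fin by simp
  qed
  \<comment> \<open>Dividing by \<open>m t\<close> recovers each coordinate of \<open>x\<close> from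
    those of \<open>f x\<close>.\<close>
  have "inj ((*v) (matrix f))"
  proof (rule injI)
    fix x y assume "matrix f *v x = matrix f *v y"
    then have "coords x t = coords y t" for t
      using coords[of x t] coords[of y t] m by (simp add: A)
    then show "x = y"
      using bij_coords by (metis bij_def ext inj_eq)
  qed
  then have inv: "invertible (matrix f)"
    using invertible_left_inverse matrix_left_invertible_injective by blast
  have "proj_map (matrix f) (Pc t) = Pc (\<sigma> t)" for t
    unfolding Pc_def proj_map_pt cv by (rule pt_scale[OF m])
  then have "proj_map (matrix f) ` TC = Pc ` range \<sigma>"
    unfolding TC_def by (simp add: image_image)
  then have "matrix f \<in> Gq"
    using inv \<sigma> unfolding Gq_def TC_def by (simp add: bij_def)
  then show ?thesis
    using cv by blast
qed

text \<open>The converse: a matrix preserving the set of frame points sends each frame vector to a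
  multiple of a frame vector. The induced map on parameters is onto because all of the cubic is hit,
  hence bijective by finiteness.\<close>

lemma Gq_monomial:
  assumes "A \<in> (Gq :: ('a ^ 4 ^ 4) set)"
  obtains \<sigma> m where "bij \<sigma>" "\<And>t. m t \<noteq> 0" "\<And>t. A *v cv t = m t *s cv (\<sigma> t)"
proof -
  have TC: "proj_map A ` TC = TC"
    using assms by (simp add: Gq_def)
  have "\<exists>s k. k \<noteq> 0 \<and> A *v cv t = k *s cv s" for t
  proof -
    have "proj_map A (Pc t) \<in> proj_map A ` TC"
      unfolding TC_def by blast
    then have "pt (A *v cv t) \<in> TC"
      unfolding TC by (simp add: Pc_def proj_map_pt)
    then show ?thesis
      unfolding TC_def Pc_def by (auto simp: pt_eq_iff)
  qed
  then obtain \<sigma> m where \<sigma>: "\<And>t. m t \<noteq> 0" "\<And>t. A *v cv t = m t *s cv (\<sigma> t)"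
    by metis
  have P: "proj_map A (Pc t) = Pc (\<sigma> t)" for t
    unfolding Pc_def proj_map_pt \<sigma> by (rule pt_scale[OF \<sigma>(1)])
  have "surj \<sigma>"
  unfolding surj_def
  proof
    fix s
    have "Pc s \<in> proj_map A ` TC"
      unfolding TC by (simp add: TC_def)
    then show "\<exists>t. s = \<sigma> t"
      unfolding TC_def by (auto simp: P Pc_eq_iff)
  qed
  then have "bij \<sigma>"
    using finite_UNIV_surj_inj[OF finite_param] by (simp add: bij_def)
  with \<sigma> show ?thesis
    by (rule that[rotated])
qed

text \<open>Monomial matrices are transitive on vectors with a given support size. It is stated for
  functions on the parameters so that it applies to \<open>coords\<close> and to
  \<open>evals\<close>.\<close>

lemma ex_Gq_same_support:
  fixes y z :: "'a option \<Rightarrow> 'a"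
  assumes "supp_size y = supp_size z"
  obtains A \<sigma> m where "A \<in> Gq" "bij \<sigma>" "\<And>t. m t \<noteq> 0" "\<And>t. A *v cv t = m t *s cv (\<sigma> t)"
    "\<And>t. z (\<sigma> t) = y t * m t"
proof -
  obtain \<sigma> :: "'a option \<Rightarrow> 'a option" where \<sigma>: "bij \<sigma>" "\<And>t. z (\<sigma> t) \<noteq> 0 \<longleftrightarrow> y t \<noteq> 0"
    using ex_bij_image_eq[OF finite_param assms[unfolded supp_size_def]] by auto
  \<comment> \<open>Off the support any nonzero multiplier would do; 1 is the default there.\<close>
  define m where "m t = (if y t = 0 then 1 else z (\<sigma> t) / y t)" for t
  have m: "m t \<noteq> 0" for t
    using \<sigma>(2)[of t] by (simp add: m_def)
  obtain A where A: "A \<in> Gq" "\<And>t. A *v cv t = m t *s cv (\<sigma> t)"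
    using ex_Gq_monomial[of \<sigma> m] \<sigma>(1) m by blast
  have "z (\<sigma> t) = y t * m t" for t
    using \<sigma>(2)[of t] by (auto simp: m_def)
  with A \<sigma>(1) m show ?thesis
    by (intro that)
qed

lemma coords_monomial:
  assumes \<sigma>: "bij \<sigma>" and A: "\<And>t. A *v cv t = m t *s cv (\<sigma> t)"
  shows "coords (A *v x) (\<sigma> t) = coords x t * (m t :: 'a)"
proof -
  have "A *v x = A *v comb (coords x)"
    by (simp add: comb_coords)
  also have "\<dots> = (\<Sum>s\<in>UNIV. (coords x s * m s) *s cv (\<sigma> s))"
    by (simp add: comb_def mult_vec_sum vector_scalar_commute A)
  finally have "coords (A *v x) (\<sigma> t) = (\<Sum>s\<in>UNIV. if s = t then coords x s * m s else 0)"
    using \<sigma> by (auto simp: coords_sum coords_scale coords_cv bij_def inj_eq intro!: sum.cong)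
  then show ?thesis
    using finite_param by simp
qed

text \<open>A monomial matrix permutes and rescales coordinates, so it preserves the support size;
  conversely, equal support sizes are matched by some element of the group.\<close>

lemma point_orbit_pt: "point_orbit (pt x) = weight_points (supp_size (coords (x :: 'a ^ 4)))"
proof (intro equalityI subsetI)
  fix p assume "p \<in> point_orbit (pt x)"
  then obtain A where A: "A \<in> Gq" "p = pt (A *v x)"
    unfolding point_orbit_def by (auto simp: proj_map_pt)
  obtain \<sigma> m where m: "bij \<sigma>" "\<And>t. m t \<noteq> 0" "\<And>t. A *v cv t = m t *s cv (\<sigma> t)"
    using Gq_monomial[OF A(1)] by blast
  have "supp_size (coords (A *v x)) = supp_size (coords x)"
    by (rule supp_size_bij[OF m(1)]) (simp add: coords_monomial[OF m(1,3)] m(2))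
  then show "p \<in> weight_points (supp_size (coords x))"
    by (simp add: A pt_mem_weight_points_iff)
next
  fix p :: "('a ^ 4) set" assume "p \<in> weight_points (supp_size (coords x))"
  then obtain x' where x': "p = pt x'" "supp_size (coords x) = supp_size (coords x')"
    unfolding weight_points_def by auto
  obtain A \<sigma> m where A: "A \<in> Gq" "bij \<sigma>" "\<And>t. A *v cv t = m t *s cv (\<sigma> t)"
    "\<And>t. coords x' (\<sigma> t) = coords x t * m t"
    using ex_Gq_same_support[OF x'(2)] by metis
  have "coords (A *v x) (\<sigma> t) = coords x' (\<sigma> t)" for t
    by (simp add: coords_monomial[OF A(2,3)] A(4))
  then have "coords (A *v x) = coords x'"
    using A(2) by (metis bij_pointE ext)
  then have "A *v x = x'"
    using bij_coords by (metis bij_def inj_eq)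
  then show "p \<in> point_orbit (pt x)"
    unfolding point_orbit_def using A(1) by (auto simp: proj_map_pt x'(1))
qed

section \<open>Planes classified by the values of their forms on the cubic\<close>

lemma card_pl_TC:
  assumes "c \<noteq> 0"
  shows "card (pl c \<inter> TC) = 4 - supp_size (evals (c :: 'a ^ 4))"
proof -
  have "pl c \<inter> TC = Pc ` {t. evals c t = 0}"
    unfolding TC_def Pc_def evals_def using cv_neq_0 by (auto simp: pt_mem_pl_iff)
  moreover have "inj (Pc :: 'a option \<Rightarrow> _)"
    by (simp add: inj_def Pc_eq_iff)
  ultimately have "card (pl c \<inter> TC) = card {t. evals c t = 0}"
    by (metis card_image inj_on_subset subset_UNIV)
  also have "{t. evals c t = 0} = - {t. evals c t \<noteq> 0}"
    by auto
  also have "card \<dots> = CARD('a option) - supp_size (evals c)"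
    unfolding Compl_eq_Diff_UNIV supp_size_def
    using finite_param by (intro card_Diff_subset) (auto intro: finite_subset)
  finally show ?thesis
    by (simp only: card_param)
qed

lemma supp_size_le_4: "supp_size (y :: 'a option \<Rightarrow> 'a) \<le> 4"
  unfolding supp_size_def card_param[symmetric]
  by (rule card_mono[OF finite_param]) simp

lemma supp_size_evals_eq_0_iff: "supp_size (evals c) = 0 \<longleftrightarrow> c = (0 :: 'a ^ 4)"
proof -
  have fin: "finite {t. evals c t \<noteq> 0}"
    using finite_param by (rule finite_subset[rotated]) simp
  have 0: "evals 0 = (\<lambda>t. 0 :: 'a)"
    by (simp add: evals_def dotv_def fun_eq_iff)
  have "supp_size (evals c) = 0 \<longleftrightarrow> evals c = evals 0"
    using fin by (auto simp: supp_size_def 0 fun_eq_iff)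
  then show ?thesis
    using bij_evals by (simp add: bij_def inj_eq)
qed

lemma supp_size_coords_eq_0_iff: "supp_size (coords x) = 0 \<longleftrightarrow> x = (0 :: 'a ^ 4)"
proof -
  have fin: "finite {t. coords x t \<noteq> 0}"
    using finite_param by (rule finite_subset[rotated]) simp
  have 0: "coords 0 = (\<lambda>t. 0 :: 'a)"
    by (simp add: coords_def fun_eq_iff split: option.split)
  have "supp_size (coords x) = 0 \<longleftrightarrow> coords x = coords 0"
    using fin by (auto simp: supp_size_def 0 fun_eq_iff)
  then show ?thesis
    using bij_coords by (simp add: bij_def inj_eq)
qed

text \<open>Indexed by the number \<open>w\<close> of cubic points off the plane. The bound on
  \<open>w\<close> keeps the natural subtraction injective, and \<open>w\<close> nonzero excludes
  the zero form.\<close>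

lemma d_planes_eq:
  assumes "w \<noteq> 0" "w \<le> 4"
  shows "d_planes (4 - w) = pl ` {c :: 'a ^ 4. supp_size (evals c) = w}"
proof -
  have "4 - supp_size (evals c) = 4 - w \<longleftrightarrow> supp_size (evals c) = w" for c :: "'a ^ 4"
    using supp_size_le_4[of "evals c"] assms by linarith
  moreover have "c \<noteq> 0" if "supp_size (evals c) = w" for c :: "'a ^ 4"
    using that assms supp_size_evals_eq_0_iff[of c] by simp
  ultimately show ?thesis
    unfolding d_planes_def pg_planes_def by (auto simp: card_pl_TC)
qed

lemma card_d_planes:
  assumes "w \<noteq> 0" "w \<le> 4"
  shows "2 * card (d_planes (4 - w) :: ('a ^ 4) set set set) = (4 choose w) * 2 ^ w"
proof -
  have "0 \<notin> {c :: 'a ^ 4. supp_size (evals c) = w}"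
    using assms supp_size_evals_eq_0_iff[of 0] by simp
  moreover have "evals (k *s c) = (\<lambda>t. k * evals c t)" for k and c :: "'a ^ 4"
    by (simp add: evals_def dotv_scale_left fun_eq_iff)
  ultimately show ?thesis
    using card_pt_image_support[OF bij_evals _ assms(1)]
    by (simp add: d_planes_eq[OF assms] card_pl_image)
qed

text \<open>The dual of \<open>point_orbit_pt\<close>: a monomial matrix permutes and rescales the
  values of a form on the frame, so exactly the number of zeros among them is invariant.\<close>

lemma plane_orbit_pl:
  assumes c: "c \<noteq> 0"
  shows "plane_orbit (pl c) = d_planes (card (pl c \<inter> (TC :: ('a ^ 4) set set)))"
proof (intro equalityI subsetI)
  \<comment> \<open>By linearity, the pairing condition of \<open>proj_map_pl\<close> need only be
    checked on the basis \<open>cv t\<close>.\<close>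
  have dotv: "dotv d (A *v x) = dotv c x" if "\<And>t. dotv d (A *v cv t) = dotv c (cv t)"
    for d x :: "'a ^ 4" and A
  proof -
    have "dotv d (A *v comb (coords x)) = dotv c (comb (coords x))"
      by (simp add: comb_def mult_vec_sum vector_scalar_commute dotv_sum dotv_scale that)
    then show ?thesis
      by (simp add: comb_coords)
  qed
  {
    fix p :: "('a ^ 4) set set" assume "p \<in> plane_orbit (pl c)"
    then obtain A where A: "A \<in> Gq" "p = proj_map A ` pl c"
      unfolding plane_orbit_def by auto
    obtain \<sigma> m where m: "bij \<sigma>" "\<And>t. m t \<noteq> 0" "\<And>t. A *v cv t = m t *s cv (\<sigma> t)"
      using Gq_monomial[OF A(1)] by blast
    \<comment> \<open>The image form: its values are moved along \<sigma> and divided by the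
      multipliers, and it exists because \<open>evals\<close> is onto.\<close>
    obtain d :: "'a ^ 4" where "evals d = (\<lambda>s. evals c (inv \<sigma> s) / m (inv \<sigma> s))"
      using bij_evals by (metis bij_pointE)
    then have d: "evals d (\<sigma> t) = evals c t / m t" for t
      using m(1) by (simp add: bij_def)
    have "dotv d (A *v cv t) = dotv c (cv t)" for t
      using d[of t] m(2)[of t] by (simp add: m(3) dotv_scale evals_def)
    then have p: "p = pl d"
      using A dotv proj_map_pl[of A d c] by (simp add: Gq_def)
    have eq: "supp_size (evals d) = supp_size (evals c)"
      by (rule supp_size_bij[OF m(1)]) (simp add: d m(2))
    then have "d \<noteq> 0"
      using c by (metis supp_size_evals_eq_0_iff)
    then show "p \<in> d_planes (card (pl c \<inter> TC))"
      using c eq unfolding p d_planes_def pg_planes_def by (auto simp: card_pl_TC)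
  }
  {
    fix p :: "('a ^ 4) set set" assume "p \<in> d_planes (card (pl c \<inter> TC))"
    then obtain d :: "'a ^ 4" where d: "p = pl d" "d \<noteq> 0" "card (pl d \<inter> TC) = card (pl c \<inter> TC)"
      unfolding d_planes_def pg_planes_def by auto
    then have "supp_size (evals c) = supp_size (evals d)"
      using c supp_size_le_4[of "evals c"] supp_size_le_4[of "evals d"] by (simp add: card_pl_TC)
    then obtain A \<sigma> m where A: "A \<in> Gq" "\<And>t. m t \<noteq> 0" "\<And>t. A *v cv t = m t *s cv (\<sigma> t)"
      "\<And>t. evals d (\<sigma> t) = evals c t * m t"
      using ex_Gq_same_support by metis
    \<comment> \<open>The chosen matrix multiplies the values by \<open>m t\<close>, whereas the
      dual action divides by it; over F_3 the two agree.\<close>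
    have "m t * m t = 1" for t
      using F3_cases[of "m t"] A(2)[of t] by auto
    then have "dotv d (A *v cv t) = dotv c (cv t)" for t
      using A(4)[of t] by (simp add: A(3) dotv_scale evals_def mult.left_commute)
    then have "p = proj_map A ` pl c"
      using A(1) d(1) dotv proj_map_pl[of A d c] by (simp add: Gq_def)
    then show "p \<in> plane_orbit (pl c)"
      unfolding plane_orbit_def using A(1) by blast
  }
qed

subsection \<open>The geometric types in terms of coordinates\<close>

lemma TC_eq: "TC = (weight_points 1 :: ('a ^ 4) set set)"
proof (intro equalityI subsetI)
  fix p assume "p \<in> (TC :: ('a ^ 4) set set)"
  then obtain s where "p = pt (cv s)"
    by (auto simp: TC_def Pc_def)
  then show "p \<in> weight_points 1"
    by (simp add: pt_mem_weight_points_iff supp_size_def coords_cv if_distrib cong: if_cong)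
next
  fix p assume "p \<in> (weight_points 1 :: ('a ^ 4) set set)"
  then obtain x where x: "p = pt x" "card {t. coords x t \<noteq> 0} = 1"
    by (auto simp: weight_points_def supp_size_def)
  then obtain s where "{t. coords x t \<noteq> 0} = {s}"
    by (auto simp: card_1_singleton_iff)
  then have s: "coords x t \<noteq> 0 \<longleftrightarrow> t = s" for t
    by blast
  have "x = comb (coords x)"
    by (simp add: comb_coords)
  also have "\<dots> = (\<Sum>t\<in>UNIV. if t = s then coords x t *s cv t else 0)"
    unfolding comb_def using s by (intro sum.cong) auto
  also have "\<dots> = coords x s *s cv s"
    using finite_param by simp
  finally have "p = Pc s"
    using s pt_scale[of "coords x s" "cv s"] x(1) by (simp add: Pc_def)
  then show "p \<in> TC"
    by (simp add: TC_def)
qed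

text \<open>The four summands belong to the parameters infinity, 0, 1 and -1. This form makes the
  support size computable in the case checks.\<close>

lemma supp_size_coords:
  fixes x :: "'a ^ 4"
  shows "supp_size (coords x) = of_bool (x $ 1 \<noteq> x $ 3) + of_bool (x $ 4 \<noteq> x $ 2)
    + of_bool (x $ 2 + x $ 3 \<noteq> 0) + of_bool (x $ 2 \<noteq> x $ 3)"
proof -
  have "supp_size (coords x) = (\<Sum>t\<in>UNIV. of_bool (coords x t \<noteq> 0))"
    using finite_param by (simp add: supp_size_def)
  also have "\<dots> = of_bool (x $ 1 - x $ 3 \<noteq> 0) + of_bool (x $ 4 - x $ 2 \<noteq> 0)
    + of_bool (- x $ 2 - x $ 3 \<noteq> 0) + of_bool (- x $ 2 + x $ 3 \<noteq> 0)"
    unfolding sum_param by (simp add: coords_def)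
  also have "- x $ 2 - x $ 3 = - (x $ 2 + x $ 3)"
    by simp
  finally show ?thesis
    by (simp only: neg_equal_0_iff_equal uminus_add_conv_diff right_minus_eq eq_commute[of "x $ 3" "x $ 2"])
qed

lemma pt_mem_axisA_iff: "pt x \<in> axisA \<longleftrightarrow> x \<noteq> 0 \<and> x $ 1 = 0 \<and> (x :: 'a ^ 4) $ 4 = 0"
proof -
  have "pt x \<in> axisA" if "x \<noteq> 0" "x $ 1 = 0" "x $ 4 = 0"
  proof -
    have "x = vector [0, x $ 2, x $ 3, 0]"
      using that by (simp add: vec_eq_iff forall_4)
    moreover have "x $ 2 \<noteq> 0 \<or> x $ 3 \<noteq> 0"
      using that by (auto simp: vec_eq_iff forall_4)
    ultimately show ?thesis
      unfolding axisA_def mem_Collect_eq by metis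
  qed
  moreover have "x \<noteq> 0 \<and> x $ 1 = 0 \<and> x $ 4 = 0" if "pt x \<in> axisA"
    using that unfolding axisA_def by (auto simp: pt_eq_iff vec_eq_iff forall_4)
  ultimately show ?thesis
    by blast
qed

lemma pt_mem_tangent_None_iff:
  "pt x \<in> tangent None \<longleftrightarrow> x \<noteq> 0 \<and> x $ 3 = 0 \<and> (x :: 'a ^ 4) $ 4 = 0"
  by (auto simp: pt_mem_line_through_iff vec_eq_iff forall_4)

lemma pt_mem_tangent_Some_iff:
  "pt x \<in> tangent (Some t) \<longleftrightarrow>
    x \<noteq> 0 \<and> x $ 1 = t * x $ 4 \<and> x $ 2 = - (t^2 * x $ 4) - t * (x :: 'a ^ 4) $ 3"
proof -
  have "(\<exists>a b. x = a *s vector [t^3, t^2, t, 1] + b *s vector [3 * t^2, 2 * t, 1, 0])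
      \<longleftrightarrow> x $ 1 = t * x $ 4 \<and> x $ 2 = - (t^2 * x $ 4) - t * x $ 3"
  proof
    assume R: "x $ 1 = t * x $ 4 \<and> x $ 2 = - (t^2 * x $ 4) - t * x $ 3"
    \<comment> \<open>The fourth entry determines the first coefficient, and then the third entry
      determines the second.\<close>
    have "x = x $ 4 *s vector [t^3, t^2, t, 1] + (x $ 3 - t * x $ 4) *s vector [3 * t^2, 2 * t, 1, 0]"
      unfolding vec_eq_iff forall_4 using R F3_cases[of t] F3_cases[of "x $ 4"] F3_cases[of "x $ 3"]
      by (auto simp: F3_two F3_three)
    then show "\<exists>a b. x = a *s vector [t^3, t^2, t, 1] + b *s vector [3 * t^2, 2 * t, 1, 0]"
      by blast
  next
    assume "\<exists>a b. x = a *s vector [t^3, t^2, t, 1] + b *s vector [3 * t^2, 2 * t, 1, 0]"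
    then obtain a b where x: "x = a *s vector [t^3, t^2, t, 1] + b *s vector [3 * t^2, 2 * t, 1, 0]"
      by blast
    show "x $ 1 = t * x $ 4 \<and> x $ 2 = - (t^2 * x $ 4) - t * x $ 3"
      unfolding x using F3_cases[of t] F3_cases[of a] F3_cases[of b]
      by (auto simp: F3_two F3_three)
  qed
  then show ?thesis
    by (simp add: pt_mem_line_through_iff)
qed

lemma ex_tangent_iff:
  fixes x :: "'a ^ 4"
  shows "(\<exists>t. pt x \<in> tangent t) \<longleftrightarrow> x \<noteq> 0 \<and> (x $ 3 = 0 \<and> x $ 4 = 0 \<or> x $ 1 = 0 \<and> x $ 2 = 0
    \<or> x $ 1 = x $ 4 \<and> x $ 2 = - x $ 4 - x $ 3 \<or> x $ 1 = - x $ 4 \<and> x $ 2 = - x $ 4 + x $ 3)"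
proof -
  have "(\<exists>t. Q t) \<longleftrightarrow> Q None \<or> Q (Some 0) \<or> Q (Some 1) \<or> Q (Some (-1))"
    for Q :: "'a option \<Rightarrow> bool"
    using all_param[of "\<lambda>t. \<not> Q t"] by blast
  from this[of "\<lambda>t. pt x \<in> tangent t"] show ?thesis
    unfolding pt_mem_tangent_None_iff pt_mem_tangent_Some_iff by auto
qed

text \<open>Each tangent has four points: its point of contact, one point of the axis, and two with
  all coordinates nonzero. All three claims are finite checks over the entries of
  \<open>x\<close>.\<close>

lemma supp_size_axis_tangent:
  fixes x :: "'a ^ 4"
  shows "pt x \<in> axisA \<Longrightarrow> supp_size (coords x) = 3"
    and "pt x \<in> tangent t \<Longrightarrow> supp_size (coords x) \<noteq> 1 \<Longrightarrow> pt x \<notin> axisA \<Longrightarrow> supp_size (coords x) = 4"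
    and "supp_size (coords x) = 4 \<Longrightarrow> \<exists>t. pt x \<in> tangent t"
proof -
  note cases = F3_cases[of "x $ 1"] F3_cases[of "x $ 2"]
    F3_cases[of "x $ 3"] F3_cases[of "x $ 4"]
  note simps = neg1_neq_1 neg1_neq_1[symmetric] F3_two
  show "pt x \<in> axisA \<Longrightarrow> supp_size (coords x) = 3"
    unfolding pt_mem_axisA_iff supp_size_coords vec_eq_iff[of x] forall_4
    using cases by (elim disjE) (simp_all add: simps)
  show "\<exists>t. pt x \<in> tangent t" if "supp_size (coords x) = 4"
    using that cases unfolding ex_tangent_iff supp_size_coords vec_eq_iff[of x] forall_4
    by (elim disjE) (simp_all add: simps)
  assume "pt x \<in> tangent t" "supp_size (coords x) \<noteq> 1" "pt x \<notin> axisA"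
  moreover from this(1) have "\<exists>t. pt x \<in> tangent t" ..
  ultimately show "supp_size (coords x) = 4"
    using cases unfolding ex_tangent_iff supp_size_coords pt_mem_axisA_iff vec_eq_iff[of x] forall_4
    by (elim disjE) (simp_all add: simps)
qed

lemma points_eq_weights: "(pg_points :: ('a ^ 4) set set) =
    weight_points 1 \<union> weight_points 2 \<union> weight_points 3 \<union> weight_points 4"
proof -
  have "n = 1 \<or> n = 2 \<or> n = 3 \<or> n = 4 \<longleftrightarrow> n \<noteq> 0" if "n \<le> 4" for n :: nat
    using that by arith
  then have "supp_size (coords x) = 1 \<or> supp_size (coords x) = 2 \<or> supp_size (coords x) = 3
      \<or> supp_size (coords x) = 4 \<longleftrightarrow> x \<noteq> 0" for x :: "'a ^ 4"
    using supp_size_le_4[of "coords x"] supp_size_coords_eq_0_iff[of x] by metis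
  then show ?thesis
    unfolding pg_points_def weight_points_def by blast
qed

text \<open>A chord is spanned by two frame vectors, so its points have support inside a pair of
  parameters; the hypothesis removes the two end points.\<close>

lemma mem_real_chord_iff:
  fixes x :: "'a ^ 4"
  assumes "supp_size (coords x) \<noteq> 1"
  shows "(\<exists>L\<in>real_chords. pt x \<in> L) \<longleftrightarrow> supp_size (coords x) = 2"
proof
  assume "\<exists>L\<in>real_chords. pt x \<in> L"
  then obtain r s :: "'a option" and a b where x: "x = a *s cv r + b *s cv s" "x \<noteq> 0"
    unfolding real_chords_def by (auto simp: pt_mem_line_through_iff)
  have "{t. coords x t \<noteq> 0} \<subseteq> {r, s}"
    unfolding x by (auto simp: coords_add coords_scale coords_cv split: if_splits)
  then have "supp_size (coords x) \<le> card {r, s}"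
    unfolding supp_size_def by (intro card_mono) auto
  also have "\<dots> \<le> 2"
    by (simp add: card_insert_if)
  finally show "supp_size (coords x) = 2"
    using assms supp_size_coords_eq_0_iff[of x] x(2) by linarith
next
  assume "supp_size (coords x) = 2"
  then obtain r s where rs: "{t. coords x t \<noteq> 0} = {r, s}" "r \<noteq> s"
    unfolding supp_size_def card_2_iff by blast
  have "x = comb (coords x)"
    by (simp add: comb_coords)
  also have "\<dots> = (\<Sum>t\<in>{r, s}. coords x t *s cv t)"
    unfolding comb_def using rs(1) finite_param by (intro sum.mono_neutral_right) auto
  also have "\<dots> = coords x r *s cv r + coords x s *s cv s"
    using rs(2) by simp
  finally have "x = coords x r *s cv r + coords x s *s cv s" .
  moreover have "x \<noteq> 0"
    using \<open>supp_size (coords x) = 2\<close> supp_size_coords_eq_0_iff[of x] by auto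
  ultimately have "pt x \<in> line_through (cv r) (cv s)"
    unfolding pt_mem_line_through_iff by blast
  then show "\<exists>L\<in>real_chords. pt x \<in> L"
    unfolding real_chords_def using rs(2) by blast
qed

lemma TO_points_eq: "TO_points = (weight_points 4 :: ('a ^ 4) set set)"
proof (rule point_set_eqI)
  show "pt x \<in> TO_points \<longleftrightarrow> pt x \<in> weight_points 4" if "x \<noteq> 0" for x :: "'a ^ 4"
  proof -
    have "pt x \<notin> axisA" "supp_size (coords x) \<noteq> 1" if "supp_size (coords x) = 4"
      using that supp_size_axis_tangent(1)[of x] by auto
    then show ?thesis
      using \<open>x \<noteq> 0\<close> supp_size_axis_tangent(2,3)[of x]
      unfolding TO_points_def mem_Collect_eq Un_iff TC_eq pt_mem_weight_points_iff pt_mem_points_iff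
      by blast
  qed
qed (auto simp: TO_points_def points_eq_weights)

lemma RC_points_eq: "RC_points = (weight_points 2 :: ('a ^ 4) set set)"
proof (rule point_set_eqI)
  show "pt x \<in> RC_points \<longleftrightarrow> pt x \<in> weight_points 2" if "x \<noteq> 0" for x :: "'a ^ 4"
  proof -
    have "pt x \<notin> axisA" "supp_size (coords x) \<noteq> 1" "supp_size (coords x) \<noteq> 4"
      if "supp_size (coords x) = 2"
      using that supp_size_axis_tangent(1)[of x] by auto
    then show ?thesis
      using \<open>x \<noteq> 0\<close> supp_size_axis_tangent(2,3)[of x] mem_real_chord_iff[of x]
      unfolding RC_points_def mem_Collect_eq Un_iff TC_eq pt_mem_weight_points_iff pt_mem_points_iff
      by blast
  qed
qed (auto simp: RC_points_def points_eq_weights)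

lemma axisA_subset: "axisA \<subseteq> (weight_points 3 :: ('a ^ 4) set set)"
  using supp_size_axis_tangent(1) pt_mem_weight_points_iff unfolding axisA_def by fastforce

text \<open>Cubic, RC- and TO-points exhaust the support sizes 1, 2 and 4, which leaves size 3
  without the axis.\<close>

lemma IC_points_eq: "IC_points = weight_points 3 - (axisA :: ('a ^ 4) set set)"
  using weight_points_disjoint[of 1 3] weight_points_disjoint[of 2 3] weight_points_disjoint[of 4 3]
  unfolding IC_points_def TO_points_eq RC_points_eq TC_eq points_eq_weights by auto

lemma card_axisA: "card (axisA :: ('a ^ 4) set set) = 4"
proof -
  let ?v = "\<lambda>(a, b). vector [0, a, b, 0] :: 'a ^ 4"
  let ?X = "?v ` (UNIV - {(0, 0)})"
  have "inj ?v"
    by (auto simp: inj_def vec_eq_iff forall_4)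
  then have "card ?X = card (UNIV - {(0 :: 'a, 0 :: 'a)})"
    by (metis card_image inj_on_subset subset_UNIV)
  \<comment> \<open>There are 9 pairs \<open>(a, b)\<close>, and the zero pair is removed; the 8
    vectors then form 4 opposite pairs.\<close>
  also have "\<dots> = 8"
    using q3 by (simp add: card_Diff_subset card_cartesian_product flip: UNIV_Times_UNIV)
  finally have "card ?X = 8" .
  moreover have "- x \<in> ?X" if x: "x \<in> ?X" for x
  proof -
    obtain a b where "x = ?v (a, b)" "(a, b) \<noteq> (0, 0)"
      using x by auto
    then have "- x = ?v (- a, - b)" "(- a, - b) \<noteq> (0, 0)"
      by (auto simp: vec_eq_iff forall_4)
    then show ?thesis
      by blast
  qed
  moreover have "0 \<notin> ?X"
    by (auto simp: vec_eq_iff forall_4)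
  ultimately have "2 * card (pt ` ?X) = 8"
    using card_pt_image[of ?X] finite_space by auto
  moreover have "pt ` ?X = axisA"
    unfolding axisA_def image_image by (force simp: image_iff)
  ultimately show ?thesis
    by simp
qed

section \<open>Osculating planes\<close>

lemma osc_Int_TC: "osc t \<inter> TC = {Pc t :: ('a ^ 4) set}"
proof -
  \<comment> \<open>The left side is the cube of \<open>s - u\<close>, and cubing is the identity on
    F_3.\<close>
  have "dotv (vector [1, -3*u, 3*u^2, -(u^3)]) (cv (Some s)) = s - (u :: 'a)" for s u
    using F3_cases[of u] F3_cases[of s]
    by (auto simp: dotv_def sum_4 F3_three)
  then have "Pc s \<in> osc t \<longleftrightarrow> s = t" for s
    unfolding Pc_def by (cases s; cases t)
      (auto simp: pt_mem_pl_iff cv_neq_0[of None, simplified] cv_neq_0[of "Some _", simplified]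
        dotv_def sum_4)
  then show ?thesis
    unfolding TC_def by auto
qed

lemma Gamma_planes_subset: "Gamma_planes \<subseteq> (d_planes 1 :: ('a ^ 4) set set set)"
proof -
  have "osc t \<in> (pg_planes :: ('a ^ 4) set set set)" for t
    unfolding pg_planes_def by (cases t) (auto intro!: exI simp: vec_eq_iff forall_4)
  then show ?thesis
    unfolding Gamma_planes_def d_planes_def by (auto simp: osc_Int_TC)
qed

text \<open>Osculating planes at different parameters are distinct, since each meets the cubic in
  its own point only.\<close>

lemma card_Gamma_planes: "card (Gamma_planes :: ('a ^ 4) set set set) = 4"
proof -
  have "inj (osc :: 'a option \<Rightarrow> _)"
    using osc_Int_TC Pc_eq_iff by (metis injI singleton_inject)
  then show ?thesis
    unfolding Gamma_planes_def by (simp add: card_image card_param)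
qed

end

section \<open>The orbits and their sizes\<close>

theorem theorem5p2:
  assumes q3: "CARD('a::field) = 3"
  shows
    "plane_orbits = {Gamma_planes \<union> one_bar_planes, d_planes 2, d_planes 3, d_planes 0 :: ('a ^ 4) set set set}
     \<and> card (plane_orbits :: ('a ^ 4) set set set set) = 4
     \<and> card (Gamma_planes :: ('a ^ 4) set set set) = 4
     \<and> card (one_bar_planes :: ('a ^ 4) set set set) = 12
     \<and> card (Gamma_planes \<union> one_bar_planes :: ('a ^ 4) set set set) = 16
     \<and> card (d_planes 2 :: ('a ^ 4) set set set) = 12
     \<and> card (d_planes 3 :: ('a ^ 4) set set set) = 4
     \<and> card (d_planes 0 :: ('a ^ 4) set set set) = 8
     \<and> point_orbits = {C_points, Gamma4_points \<union> IC_points, TO_points, RC_points :: ('a ^ 4) set set}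
     \<and> card (point_orbits :: ('a ^ 4) set set set) = 4
     \<and> card (C_points :: ('a ^ 4) set set) = 4
     \<and> card (Gamma4_points :: ('a ^ 4) set set) = 4
     \<and> card (IC_points :: ('a ^ 4) set set) = 12
     \<and> card (Gamma4_points \<union> IC_points :: ('a ^ 4) set set) = 16
     \<and> card (TO_points :: ('a ^ 4) set set) = 8
     \<and> card (RC_points :: ('a ^ 4) set set) = 12"
proof -
  have W: "card (weight_points 1 :: ('a ^ 4) set set) = 4" "card (weight_points 2 :: ('a ^ 4) set set) = 12"
    "card (weight_points 3 :: ('a ^ 4) set set) = 16" "card (weight_points 4 :: ('a ^ 4) set set) = 8"
    using card_weight_points[OF q3, of 1] card_weight_points[OF q3, of 2]
      card_weight_points[OF q3, of 3] card_weight_points[OF q3, of 4]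
    by (simp_all add: numeral_eq_Suc)
  have D: "card (d_planes 3 :: ('a ^ 4) set set set) = 4" "card (d_planes 2 :: ('a ^ 4) set set set) = 12"
    "card (d_planes 1 :: ('a ^ 4) set set set) = 16" "card (d_planes 0 :: ('a ^ 4) set set set) = 8"
    using card_d_planes[OF q3, of 1] card_d_planes[OF q3, of 2]
      card_d_planes[OF q3, of 3] card_d_planes[OF q3, of 4]
    by (simp_all add: numeral_eq_Suc)
  have one_bar: "one_bar_planes = d_planes 1 - (Gamma_planes :: ('a ^ 4) set set set)"
    unfolding one_bar_planes_def d_planes_def by auto
  have G: "Gamma_planes \<union> one_bar_planes = (d_planes 1 :: ('a ^ 4) set set set)"
    using Gamma_planes_subset[OF q3] unfolding one_bar by blast
  have A: "Gamma4_points \<union> IC_points = (weight_points 3 :: ('a ^ 4) set set)"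
    using axisA_subset[OF q3] unfolding Gamma4_points_def IC_points_eq[OF q3] by blast
  have finD: "finite (d_planes 1 :: ('a ^ 4) set set set)"
    and finW: "finite (weight_points 3 :: ('a ^ 4) set set)"
    using D(3) W(3) by (auto intro: card_ge_0_finite)
  have cG: "card (one_bar_planes :: ('a ^ 4) set set set) = 12"
    unfolding one_bar using finD D(3) Gamma_planes_subset[OF q3] card_Gamma_planes[OF q3]
    by (subst card_Diff_subset) (auto intro: finite_subset)
  have cI: "card (IC_points :: ('a ^ 4) set set) = 12"
    unfolding IC_points_eq[OF q3] using finW W(3) axisA_subset[OF q3] card_axisA[OF q3]
    by (subst card_Diff_subset) (auto intro: finite_subset)
  \<comment> \<open>No plane contains all four points of the cubic, because a form vanishing on the
    frame is zero.\<close>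
  have nonzero: "c \<noteq> 0 \<Longrightarrow> card (pl c \<inter> TC) \<in> {0, 1, 2, 3}" for c :: "'a ^ 4"
    using card_pl_TC[OF q3, of c] supp_size_le_4[OF q3, of "evals c"] supp_size_evals_eq_0_iff[OF q3, of c]
    by auto
  have PL: "plane_orbits = {d_planes 1, d_planes 2, d_planes 3, d_planes 0 :: ('a ^ 4) set set set}"
  proof (intro equalityI subsetI)
    fix X :: "('a ^ 4) set set set" assume "X \<in> plane_orbits"
    then obtain c :: "'a ^ 4" where c: "c \<noteq> 0" "X = d_planes (card (pl c \<inter> TC))"
      unfolding plane_orbits_def pg_planes_def by (auto simp: plane_orbit_pl[OF q3])
    show "X \<in> {d_planes 1, d_planes 2, d_planes 3, d_planes 0}"
      using nonzero[OF c(1)] unfolding c(2) by (elim insertE emptyE) simp_all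
  next
    \<comment> \<open>A nonempty class is the orbit of any of its members; nonemptiness comes from
      the sizes in \<open>D\<close>.\<close>
    have "d_planes k \<in> (plane_orbits :: ('a ^ 4) set set set set)"
      if nz: "card (d_planes k :: ('a ^ 4) set set set) \<noteq> 0" for k
    proof -
      obtain p :: "('a ^ 4) set set" where "p \<in> d_planes k"
        using nz by fastforce
      then obtain c where "c \<noteq> 0" "p = pl c" "card (pl c \<inter> TC) = k"
        unfolding d_planes_def pg_planes_def by auto
      then show ?thesis
        unfolding plane_orbits_def pg_planes_def using plane_orbit_pl[OF q3, of c] by blast
    qed
    then show "X \<in> plane_orbits"
      if "X \<in> {d_planes 1, d_planes 2, d_planes 3, d_planes 0}" for X :: "('a ^ 4) set set set"
      using that D by auto
  qed
  have PO: "point_orbits = {weight_points 1, weight_points 3, weight_points 4, weight_points 2 :: ('a ^ 4) set set}"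
  proof (intro equalityI subsetI)
    fix X :: "('a ^ 4) set set" assume "X \<in> point_orbits"
    then show "X \<in> {weight_points 1, weight_points 3, weight_points 4, weight_points 2}"
      unfolding point_orbits_def points_eq_weights[OF q3]
      by (auto simp: weight_points_def point_orbit_pt[OF q3])
  next
    have "weight_points k \<in> (point_orbits :: ('a ^ 4) set set set)"
      if nz: "card (weight_points k :: ('a ^ 4) set set) \<noteq> 0" and k: "k \<noteq> 0" for k
    proof -
      obtain x :: "'a ^ 4" where x: "supp_size (coords x) = k"
        using nz unfolding weight_points_def by fastforce
      then have "pt x \<in> pg_points"
        using k supp_size_coords_eq_0_iff[OF q3, of x] by (simp add: pt_mem_points_iff)
      then show ?thesis
        unfolding point_orbits_def using point_orbit_pt[OF q3, of x] x by blast
    qed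
    then show "X \<in> point_orbits"
      if "X \<in> {weight_points 1, weight_points 3, weight_points 4, weight_points 2}" for X :: "('a ^ 4) set set"
      using that W by auto
  qed
  \<comment> \<open>The four classes have different sizes, so they are distinct, which gives the
    number of orbits for planes and points alike.\<close>
  have distinct: "card {w, x, y, z} = 4"
    if "card w = 16" "card x = 12" "card y = 4" "card z = 8" for w x y z :: "'b set"
    using that by (subst card_insert_disjoint; auto)+
  show ?thesis
    unfolding G A C_points_def TC_eq[OF q3] TO_points_eq[OF q3] RC_points_eq[OF q3]
    using PL PO W D cG cI card_Gamma_planes[OF q3] card_axisA[OF q3]
      distinct[OF D(3,2,1,4)] distinct[OF W(3,2,1,4)]
    by (simp add: Gamma4_points_def insert_commute)
qed

end
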